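(* Let $R$ be a centrally morphic ring (associative with identity). Suppose that (1) the center $Z(R)$ is von Neumann regular; and (2) $R$ satisfies the ascending chain condition on principal right annihilators. Then $R$ is strongly $\pi$-regular.
   Context: For a ring $R$ and $a\in R$, $\operatorname{r.ann}_R(a)=\{x\in R: ax=0\}$ and $\operatorname{l.ann}_R(a)=\{x\in R: xa=0\}$; $Z(R)$ denotes the center of $R$. $R$ is centrally morphic if it is centrally morphic on both sides: for every $a\in R$ there exist $b,c\in Z(R)$ such that $\operatorname{r.ann}_R(a)=bR$ and $aR=\operatorname{r.ann}_R(b)$, and $\operatorname{l.ann}_R(a)=Rc$ and $Ra=\operatorname{l.ann}_R(c)$. A principal right annihilator is a right ideal of the form $\operatorname{r.ann}_R(a)$ with $a\in R$; the ascending chain condition on these says that every ascending chain of such right ideals stabilizes. A ring $T$ is von Neumann regular if for every $z\in T$ there is $x\in T$ with $z=zxz$. $R$ is strongly $\pi$-regular if for every $a\in R$ there exist an integer $t\ge 1$ and $r,u\in R$ such that $a^t=a^{t+1}r$ and $a^t=ua^{t+1}$. *)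

theory Defs
  imports "HOL-Algebra.Algebra"
begin

definition r_ann :: "('a, 'b) ring_scheme \<Rightarrow> 'a \<Rightarrow> 'a set" where
  "r_ann R a = {x \<in> carrier R. a \<otimes>\<^bsub>R\<^esub> x = \<zero>\<^bsub>R\<^esub>}"

definition l_ann :: "('a, 'b) ring_scheme \<Rightarrow> 'a \<Rightarrow> 'a set" where
  "l_ann R a = {x \<in> carrier R. x \<otimes>\<^bsub>R\<^esub> a = \<zero>\<^bsub>R\<^esub>}"

definition center :: "('a, 'b) ring_scheme \<Rightarrow> 'a set" where
  "center R = {z \<in> carrier R. \<forall>x \<in> carrier R. z \<otimes>\<^bsub>R\<^esub> x = x \<otimes>\<^bsub>R\<^esub> z}"

(* The cosets are taken in the multiplicative monoid of R, so that
   a <# carrier R is the right ideal aR and carrier R #> a is the left ideal Ra. *)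
definition centrally_morphic :: "('a, 'b) ring_scheme \<Rightarrow> bool" where
  "centrally_morphic R \<longleftrightarrow>
     (\<forall>a \<in> carrier R. \<exists>b \<in> center R. \<exists>c \<in> center R.
        r_ann R a = b <#\<^bsub>R\<^esub> carrier R \<and>
        a <#\<^bsub>R\<^esub> carrier R = r_ann R b \<and>
        l_ann R a = carrier R #>\<^bsub>R\<^esub> c \<and>
        carrier R #>\<^bsub>R\<^esub> a = l_ann R c)"

definition principal_right_annihilator :: "('a, 'b) ring_scheme \<Rightarrow> 'a set \<Rightarrow> bool" where
  "principal_right_annihilator R I \<longleftrightarrow> (\<exists>a \<in> carrier R. I = r_ann R a)"

definition acc_principal_right_annihilators :: "('a, 'b) ring_scheme \<Rightarrow> bool" where
  "acc_principal_right_annihilators R \<longleftrightarrow>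
     (\<forall>I :: nat \<Rightarrow> 'a set.
        (\<forall>n. principal_right_annihilator R (I n)) \<longrightarrow>
        (\<forall>n. I n \<subseteq> I (Suc n)) \<longrightarrow>
        (\<exists>N. \<forall>n \<ge> N. I n = I N))"

definition von_neumann_regular :: "('a, 'b) ring_scheme \<Rightarrow> bool" where
  "von_neumann_regular T \<longleftrightarrow>
     (\<forall>z \<in> carrier T. \<exists>x \<in> carrier T. z = z \<otimes>\<^bsub>T\<^esub> x \<otimes>\<^bsub>T\<^esub> z)"

definition strongly_pi_regular :: "('a, 'b) ring_scheme \<Rightarrow> bool" where
  "strongly_pi_regular R \<longleftrightarrow>
     (\<forall>a \<in> carrier R. \<exists>t :: nat. t \<ge> 1 \<and>
        (\<exists>r \<in> carrier R. \<exists>u \<in> carrier R.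
           a [^]\<^bsub>R\<^esub> t = a [^]\<^bsub>R\<^esub> (t + 1) \<otimes>\<^bsub>R\<^esub> r \<and>
           a [^]\<^bsub>R\<^esub> t = u \<otimes>\<^bsub>R\<^esub> a [^]\<^bsub>R\<^esub> (t + 1)))"

lemma (in ring) center_subcring: "subcring (center R) R"
proof (rule subcringI)
  show "subring (center R) R"
  proof (rule subringI)
    show "center R \<subseteq> carrier R" unfolding center_def by blast
    show "\<one> \<in> center R" unfolding center_def by simp
  next
    fix h assume "h \<in> center R"
    then show "\<ominus> h \<in> center R" unfolding center_def by (simp add: l_minus r_minus)
  next
    fix h k assume hk: "h \<in> center R" "k \<in> center R"
    then have c: "h \<in> carrier R" "k \<in> carrier R" unfolding center_def by blast+
    have h: "h \<otimes> x = x \<otimes> h" and k: "k \<otimes> x = x \<otimes> k" if "x \<in> carrier R" for x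
      using hk that unfolding center_def by blast+
    have "(h \<oplus> k) \<otimes> x = x \<otimes> (h \<oplus> k)" if x: "x \<in> carrier R" for x
      using h[OF x] k[OF x] c x by (simp add: l_distr r_distr)
    then show "h \<oplus> k \<in> center R" using c unfolding center_def by blast
    have "(h \<otimes> k) \<otimes> x = x \<otimes> (h \<otimes> k)" if x: "x \<in> carrier R" for x
      by (metis m_assoc h k c x)
    then show "h \<otimes> k \<in> center R" using c unfolding center_def by blast
  qed
next
  fix h k assume "h \<in> center R" "k \<in> center R"
  then show "h \<otimes> k = k \<otimes> h" unfolding center_def by blast
qed

end

theory Submission
  imports Defs
begin

text \<open>
  The ring is even strongly regular: the exponent \<open>t = 1\<close> works for every element.
  Let \<open>aR\<close> be the right annihilator of a central element \<open>b\<close>, and let \<open>b = bxb\<close>.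
  Then \<open>bx\<close> is an idempotent generating the same ideal as \<open>b\<close>, so that \<open>aR\<close> is generated by
  the complementary idempotent \<open>1 - bx\<close>, which acts as an identity on \<open>a\<close> from both sides
  because \<open>b\<close> is central. Writing \<open>1 - bx = ar\<close> gives \<open>a = a(1 - bx) = a\<^sup>2r\<close>. The left-hand
  condition gives \<open>a = ua\<^sup>2\<close> in the same way. The two lemmas carry out these two computations.
\<close>

text \<open>
  The element \<open>1 - bx\<close> is killed by \<open>b\<close>, hence lies in \<open>aR\<close>; and it fixes \<open>a\<close> under right
  multiplication, since \<open>abx = bax = 0\<close>.
\<close>
lemma (in ring) right_factor_square_if_principal_eq_r_ann:
  assumes a: "a \<in> carrier R" and b: "b \<in> center R" and x: "x \<in> carrier R"
    and reg: "b = b \<otimes> x \<otimes> b"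
    and ideal: "a <# carrier R = r_ann R b"
  shows "\<exists>r \<in> carrier R. a = a \<otimes> a \<otimes> r"
proof -
  have bc: "b \<in> carrier R" and comm: "\<And>y. y \<in> carrier R \<Longrightarrow> b \<otimes> y = y \<otimes> b"
    using b unfolding center_def by blast+
  define f where "f = \<one> \<ominus> b \<otimes> x"
  have f: "f \<in> carrier R" using bc x by (simp add: f_def)
  have "b \<otimes> f = f \<otimes> b" by (rule comm[OF f])
  also have "\<dots> = b \<ominus> b \<otimes> x \<otimes> b"
    using bc x by (simp add: f_def minus_eq l_distr l_minus)
  also have "\<dots> = \<zero>" unfolding reg[symmetric] using bc by simp
  finally have "f \<in> a <# carrier R" using f ideal by (simp add: r_ann_def)
  then obtain r where r: "r \<in> carrier R" "f = a \<otimes> r" unfolding l_coset_def by auto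
  have "a \<in> a <# carrier R" using a by (auto simp: l_coset_def intro!: bexI[of _ "\<one>"])
  then have "b \<otimes> a = \<zero>" unfolding ideal r_ann_def by blast
  then have "a \<otimes> b = \<zero>" using comm[OF a] by simp
  then have "a \<otimes> (b \<otimes> x) = \<zero>" using a bc x by (simp flip: m_assoc)
  then have "a = a \<otimes> f" using a bc x by (simp add: f_def minus_eq r_distr r_minus)
  also have "\<dots> = a \<otimes> a \<otimes> r" using a r by (simp add: m_assoc)
  finally show ?thesis using r by blast
qed

text \<open>
  The mirror image: \<open>1 - xc\<close> lies in \<open>Ra\<close> and fixes \<open>a\<close> under left multiplication.
\<close>
lemma (in ring) left_factor_square_if_principal_eq_l_ann:
  assumes a: "a \<in> carrier R" and c: "c \<in> center R" and x: "x \<in> carrier R"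
    and reg: "c = c \<otimes> x \<otimes> c"
    and ideal: "carrier R #> a = l_ann R c"
  shows "\<exists>u \<in> carrier R. a = u \<otimes> (a \<otimes> a)"
proof -
  have cc: "c \<in> carrier R" and comm: "\<And>y. y \<in> carrier R \<Longrightarrow> c \<otimes> y = y \<otimes> c"
    using c unfolding center_def by blast+
  define f where "f = \<one> \<ominus> x \<otimes> c"
  have f: "f \<in> carrier R" using cc x by (simp add: f_def)
  have "f \<otimes> c = c \<otimes> f" by (rule comm[OF f, symmetric])
  also have "\<dots> = c \<ominus> c \<otimes> x \<otimes> c"
    using cc x by (simp add: f_def minus_eq r_distr r_minus m_assoc)
  also have "\<dots> = \<zero>" unfolding reg[symmetric] using cc by simp
  finally have "f \<in> carrier R #> a" using f ideal by (simp add: l_ann_def)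
  then obtain u where u: "u \<in> carrier R" "f = u \<otimes> a" unfolding r_coset_def by auto
  have "a \<in> carrier R #> a" using a by (auto simp: r_coset_def intro!: bexI[of _ "\<one>"])
  then have "a \<otimes> c = \<zero>" unfolding ideal l_ann_def by blast
  then have "c \<otimes> a = \<zero>" using comm[OF a] by simp
  then have "x \<otimes> c \<otimes> a = \<zero>" using a cc x by (simp add: m_assoc)
  then have "a = f \<otimes> a" using a cc x by (simp add: f_def minus_eq l_distr l_minus)
  also have "\<dots> = u \<otimes> (a \<otimes> a)" using a u by (simp add: m_assoc)
  finally show ?thesis using u by blast
qed

theorem theorem2p6:
  fixes R :: "('a, 'b) ring_scheme"
  assumes "ring R"
    and "centrally_morphic R"
    and "von_neumann_regular (R\<lparr>carrier := center R\<rparr>)"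
    and "acc_principal_right_annihilators R"
  shows "strongly_pi_regular R"
proof -
  interpret ring R by fact
  have "von_neumann_regular (R\<lparr>carrier := center R\<rparr>) \<longleftrightarrow>
      (\<forall>z \<in> center R. \<exists>x \<in> center R. z = z \<otimes>\<^bsub>R\<^esub> x \<otimes>\<^bsub>R\<^esub> z)"
    by (simp add: von_neumann_regular_def)
  with assms(3) have center_regular: "\<exists>x \<in> carrier R. z = z \<otimes>\<^bsub>R\<^esub> x \<otimes>\<^bsub>R\<^esub> z"
    if "z \<in> center R" for z
    using that unfolding center_def by blast
  show ?thesis
    unfolding strongly_pi_regular_def
  proof
    fix a assume a: "a \<in> carrier R"
    obtain b c where b: "b \<in> center R" and c: "c \<in> center R"
      and right: "a <#\<^bsub>R\<^esub> carrier R = r_ann R b"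
      and left: "carrier R #>\<^bsub>R\<^esub> a = l_ann R c"
      using assms(2) a unfolding centrally_morphic_def by blast
    obtain x where x: "x \<in> carrier R" "b = b \<otimes>\<^bsub>R\<^esub> x \<otimes>\<^bsub>R\<^esub> b"
      using center_regular[OF b] by (rule bexE)
    obtain r where r: "r \<in> carrier R" "a = a \<otimes>\<^bsub>R\<^esub> a \<otimes>\<^bsub>R\<^esub> r"
      using right_factor_square_if_principal_eq_r_ann[OF a b x right] by blast
    obtain y where y: "y \<in> carrier R" "c = c \<otimes>\<^bsub>R\<^esub> y \<otimes>\<^bsub>R\<^esub> c"
      using center_regular[OF c] by (rule bexE)
    obtain u where u: "u \<in> carrier R" "a = u \<otimes>\<^bsub>R\<^esub> (a \<otimes>\<^bsub>R\<^esub> a)"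
      using left_factor_square_if_principal_eq_l_ann[OF a c y left] by blast
    have pow: "a [^]\<^bsub>R\<^esub> (1::nat) = a" "a [^]\<^bsub>R\<^esub> (1 + 1 :: nat) = a \<otimes>\<^bsub>R\<^esub> a"
      using a by simp_all
    show "\<exists>t :: nat. t \<ge> 1 \<and>
        (\<exists>r \<in> carrier R. \<exists>u \<in> carrier R.
           a [^]\<^bsub>R\<^esub> t = a [^]\<^bsub>R\<^esub> (t + 1) \<otimes>\<^bsub>R\<^esub> r \<and>
           a [^]\<^bsub>R\<^esub> t = u \<otimes>\<^bsub>R\<^esub> a [^]\<^bsub>R\<^esub> (t + 1))"
    proof (intro exI[of _ 1] conjI bexI)
      show "a [^]\<^bsub>R\<^esub> (1::nat) = a [^]\<^bsub>R\<^esub> (1 + 1 :: nat) \<otimes>\<^bsub>R\<^esub> r"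
        unfolding pow by (fact r(2))
      show "a [^]\<^bsub>R\<^esub> (1::nat) = u \<otimes>\<^bsub>R\<^esub> a [^]\<^bsub>R\<^esub> (1 + 1 :: nat)"
        unfolding pow by (fact u(2))
    qed (simp_all add: r(1) u(1))
  qed
qed

end
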